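(* Let $K$ be a convex body in $\mathbb{R}^n$ whose Santaló point is the origin, and let $t\in\mathbb{R}$ be such that $S(K,t)\ne\emptyset$ (equivalently $t\ge\frac{|K||K^0|}{v_n^2}$). Then: (i) $$\left(1-\left(\frac{|K||K^0|}{t v_n^2}\right)^{\frac1n}\right)K\subseteq S(K,t)\subseteq\left(1-\frac{|K||K^0|}{e\,t\,v_n^2}\right)K.$$ (ii) If in addition $K$ is symmetric (about the origin, $K=-K$), then $$\left(1-\left(\frac{|K||K^0|}{t v_n^2}\right)^{\frac1n}\right)K\subseteq S(K,t)\subseteq\left(1-\frac{|K||K^0|}{t v_n^2}\right)^{\frac12}K.$$
   Context: A convex body is a compact convex set with non-empty interior. $|\cdot|$ denotes $n$-dimensional volume and $v_n$ the volume of the Euclidean unit ball of $\mathbb{R}^n$. For $x\in K$, $K^x=\{y\in\mathbb{R}^n:\langle y,z-x\rangle\le 1\text{ for all }z\in K\}$ is the polar body of $K$ with respect to $x$ (of infinite volume if $x\in\partial K$); $K^0$ is the polar with respect to the origin. The Santaló point of $K$ is the unique $x_0\in\mathrm{int}(K)$ at which $x\mapsto|K||K^{x}|$ is minimal. For $t\in\mathbb{R}$ the Santaló-region is $$S(K,t)=\Bigl\{x\in K:\ \frac{|K|\,|K^x|}{v_n^2}\le t\Bigr\}.$$ Here $e$ is the base of the natural logarithm. *)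

theory Defs
  imports "HOL-Analysis.Analysis"
begin

definition convex_body :: "'a::euclidean_space set \<Rightarrow> bool" where
  "convex_body K \<longleftrightarrow> compact K \<and> convex K \<and> interior K \<noteq> {}"

definition polar :: "'a::euclidean_space set \<Rightarrow> 'a \<Rightarrow> 'a set" where
  "polar K x = {y. \<forall>z\<in>K. y \<bullet> (z - x) \<le> 1}"

(* Extended-valued, since the polar body has infinite volume when x is a boundary point of K. *)
definition vol_prod :: "'a::euclidean_space set \<Rightarrow> 'a \<Rightarrow> ennreal" where
  "vol_prod K x = emeasure lebesgue K * emeasure lebesgue (polar K x)"

(* Uniqueness of the minimiser is a theorem for convex bodies and is not part of the definition. *)
definition is_santalo_point :: "'a::euclidean_space set \<Rightarrow> 'a \<Rightarrow> bool" where
  "is_santalo_point K x0 \<longleftrightarrow>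
     x0 \<in> interior K \<and> (\<forall>x\<in>interior K. vol_prod K x0 \<le> vol_prod K x)"

definition unit_ball_volume :: "'a::euclidean_space itself \<Rightarrow> real" where
  "unit_ball_volume _ = measure lebesgue (cball (0::'a) 1)"

(* Compared in ereal, so that a negative t is not truncated to 0. *)
definition santalo_region :: "'a::euclidean_space set \<Rightarrow> real \<Rightarrow> 'a set" where
  "santalo_region K t =
     {x \<in> K. enn2ereal (vol_prod K x / ennreal ((unit_ball_volume TYPE('a))\<^sup>2)) \<le> ereal t}"

(* The quotient |K| |K^0| / v_n^2 as a real number; it is the intended value
   only if the polar of K at the origin has finite volume, as it does when 0 is interior to K. *)
definition santalo_ratio :: "'a::euclidean_space set \<Rightarrow> real" where
  "santalo_ratio K =
     measure lebesgue K * measure lebesgue (polar K 0) / (unit_ball_volume TYPE('a))\<^sup>2"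

end

theory Submission
  imports Defs "HOL-Probability.Distributions"
begin

text \<open>
  Write \<open>h\<close> for the support function of \<open>K\<close>. The whole proof rests on replacing the volume of the
  polar body by an integral in which the base point enters only through an exponential: for
  \<open>x \<in> K\<close> the function \<open>y \<mapsto> h y - y \<bullet> x\<close> is nonnegative and positively homogeneous and
  has the polar of \<open>K\<close> at \<open>x\<close> as its sublevel set at height 1, so slicing by its level sets gives
  \<open>|K\<^sup>x| \<cdot> n! = \<integral> exp (y \<bullet> x) exp (- h y) dy\<close>. Thus \<open>|K\<^sup>x|\<close> is, up to a constant, the Laplace
  transform at \<open>x\<close> of the weight \<open>exp (- h)\<close>.

  The inner inclusion is a direct comparison: if \<open>w \<in> K\<close>, then moving the base point to
  \<open>(1 - \<rho>) w\<close> enlarges the polar at most by the factor \<open>1 / \<rho>\<close>, hence its volume at most by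
  \<open>1 / \<rho>\<^sup>n\<close>.

  For the outer inclusions, a point \<open>x \<noteq> 0\<close> of \<open>K\<close> is \<open>\<rho> z\<close> with \<open>z\<close> on the boundary. An outer
  normal \<open>u\<close> at \<open>z\<close>, scaled so that \<open>h u = u \<bullet> z = 1\<close>, satisfies \<open>h (y + s u) \<le> h y + s\<close>. So
  along \<open>u\<close>, which is transversal to the levels of \<open>X = y \<bullet> z\<close>, the weight \<open>exp (- h)\<close> never decays
  faster than \<open>exp (- s)\<close>. Lemma \<open>tilt_inequality\<close> turns this into
  \<open>\<integral> f' X exp (- h) \<le> \<integral> f X exp (- h)\<close> for nonnegative convex \<open>f\<close>. The two upper bounds come
  from two choices of \<open>f\<close>.

  In general, minimality of \<open>|K\<^sup>x|\<close> at the origin says that the first moment of \<open>exp (- h)\<close>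
  vanishes; the half of this that matters is \<open>first_moment\<close>. Under this constraint the extremal law
  of \<open>X\<close> is the exponential law on \<open>[-1, \<infinity>)\<close>, with transform \<open>exp (- \<rho>) / (1 - \<rho>)\<close>, and
  \<open>laplace_lower_bound\<close> says that the transform of \<open>X\<close> is at least that large. For symmetric \<open>K\<close>
  the law of \<open>X\<close> is even, the extremal law is the two-sided exponential one with transform
  \<open>1 / (1 - \<rho>\<^sup>2)\<close>, and \<open>laplace_lower_bound_symmetric\<close> is the corresponding bound.

  Both bounds hold wherever the polar at \<open>x\<close> has finite volume, up to \<open>\<rho> = 1\<close>. At \<open>\<rho> = 1\<close> the first of them
  would force the integral of \<open>exp (- h)\<close> to vanish, so no boundary point lies in a Santalo region.
  Every point of the region is therefore interior to \<open>K\<close>, and minimality at the origin shows that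
  the region is empty below the threshold.
\<close>

section \<open>The volume of polar bodies as a Laplace transform\<close>

lemma nn_integral_exp_minus_Ici:
  "(\<integral>\<^sup>+\<tau>. ennreal (exp (- \<tau>)) * indicator {a..} \<tau> \<partial>lborel) = ennreal (exp (- a))"
proof -
  have "(\<integral>\<^sup>+\<tau>. ennreal (exp (- \<tau>)) * indicator {a..} \<tau> \<partial>lborel) = 0 - (- exp (- a))"
  proof (rule nn_integral_FTC_atLeast)
    show "((\<lambda>\<tau>::real. - exp (- \<tau>)) \<longlongrightarrow> 0) at_top"
      using tendsto_minus[OF filterlim_compose[OF exp_at_bot filterlim_uminus_at_bot_at_top]] by simp
  qed (auto intro!: derivative_eq_intros)
  then show ?thesis by simp
qed

lemma emeasure_sublevel_homogeneous:
  fixes G :: "'a::euclidean_space \<Rightarrow> real"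
  assumes hom: "\<And>c y. 0 < c \<Longrightarrow> G (c *\<^sub>R y) = c * G y" and \<tau>: "0 < \<tau>"
    and [measurable]: "G \<in> borel_measurable borel"
  shows "emeasure lborel {y. G y \<le> \<tau>} = ennreal (\<tau> ^ DIM('a)) * emeasure lborel {y. G y \<le> 1}"
proof -
  have "{y. G y \<le> \<tau>} = (\<lambda>y. \<tau> *\<^sub>R y + 0) ` {y. G y \<le> 1}"
  proof (intro set_eqI iffI)
    fix y assume "y \<in> {y. G y \<le> \<tau>}"
    then have "G ((1 / \<tau>) *\<^sub>R y) \<le> 1"
      using hom[of "1 / \<tau>" y] \<tau> by simp
    then show "y \<in> (\<lambda>y. \<tau> *\<^sub>R y + 0) ` {y. G y \<le> 1}"
      using \<tau> by (intro image_eqI[of _ _ "(1 / \<tau>) *\<^sub>R y"]) auto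
  qed (use hom \<tau> in auto)
  then have "emeasure lebesgue {y. G y \<le> \<tau>} = ennreal (\<tau> ^ DIM('a)) * emeasure lebesgue {y. G y \<le> 1}"
    using emeasure_lebesgue_affine[of \<tau> 0 "{y. G y \<le> 1}"] \<tau> by (simp add: ennreal_power)
  then show ?thesis by simp
qed

text \<open>
  Slice by the levels of \<open>G\<close>: replace \<open>exp (- G y)\<close> by the integral of \<open>exp (- \<tau>)\<close> over
  \<open>\<tau> \<ge> G y\<close> and exchange the integrals. The sublevel set at \<open>\<tau>\<close> has \<open>\<tau>\<^sup>n\<close> times the volume of the one
  at 1, and the remaining integral of \<open>\<tau>\<^sup>n exp (- \<tau>)\<close> is \<open>n!\<close>.
\<close>
lemma nn_integral_exp_homogeneous:
  fixes G :: "'a::euclidean_space \<Rightarrow> real"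
  assumes hom: "\<And>c y. 0 < c \<Longrightarrow> G (c *\<^sub>R y) = c * G y" and pos: "\<And>y. 0 \<le> G y"
    and [measurable]: "G \<in> borel_measurable borel"
  shows "(\<integral>\<^sup>+y. ennreal (exp (- G y)) \<partial>lborel) = ennreal (fact DIM('a)) * emeasure lborel {y. G y \<le> 1}"
proof -
  let ?V = "emeasure lborel {y. G y \<le> 1}"
  have "(\<integral>\<^sup>+y. ennreal (exp (- G y)) \<partial>lborel) =
      (\<integral>\<^sup>+y. (\<integral>\<^sup>+\<tau>. ennreal (exp (- \<tau>)) * indicator {G y..} \<tau> \<partial>lborel) \<partial>lborel)"
    by (simp add: nn_integral_exp_minus_Ici)
  also have "\<dots> = (\<integral>\<^sup>+y. (\<integral>\<^sup>+\<tau>. ennreal (exp (- \<tau>)) * of_bool (G y \<le> \<tau>) \<partial>lborel) \<partial>lborel)"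
    by (simp add: indicator_def)
  also have "\<dots> = (\<integral>\<^sup>+\<tau>. (\<integral>\<^sup>+y. ennreal (exp (- \<tau>)) * of_bool (G y \<le> \<tau>) \<partial>lborel) \<partial>lborel)"
    by (rule lborel_pair.Fubini') measurable
  also have "\<dots> = (\<integral>\<^sup>+\<tau>. ennreal (exp (- \<tau>)) * emeasure lborel {y. G y \<le> \<tau>} \<partial>lborel)"
  proof (rule nn_integral_cong)
    fix \<tau> :: real
    have "(\<integral>\<^sup>+y. ennreal (exp (- \<tau>)) * of_bool (G y \<le> \<tau>) \<partial>lborel) =
        (\<integral>\<^sup>+y. ennreal (exp (- \<tau>)) * indicator {y. G y \<le> \<tau>} y \<partial>lborel)"
      by (simp add: indicator_def)
    then show "(\<integral>\<^sup>+y. ennreal (exp (- \<tau>)) * of_bool (G y \<le> \<tau>) \<partial>lborel) =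
        ennreal (exp (- \<tau>)) * emeasure lborel {y. G y \<le> \<tau>}"
      by (simp add: nn_integral_cmult_indicator)
  qed
  also have "\<dots> = (\<integral>\<^sup>+\<tau>. ennreal (\<tau> ^ DIM('a) * exp (- \<tau>)) * indicator {0..} \<tau> * ?V \<partial>lborel)"
  proof (rule nn_integral_cong_AE)
    \<comment> \<open>The scaling argument says nothing about the level 0, where the sublevel set is a cone.\<close>
    have "AE \<tau> in lborel. \<tau> \<noteq> (0::real)" by (rule AE_lborel_singleton)
    then show "AE \<tau> in lborel. ennreal (exp (- \<tau>)) * emeasure lborel {y. G y \<le> \<tau>} =
        ennreal (\<tau> ^ DIM('a) * exp (- \<tau>)) * indicator {0..} \<tau> * ?V"
    proof eventually_elim
      fix \<tau> :: real assume "\<tau> \<noteq> 0"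
      then consider "0 < \<tau>" | "\<tau> < 0" by linarith
      then show "ennreal (exp (- \<tau>)) * emeasure lborel {y. G y \<le> \<tau>} =
        ennreal (\<tau> ^ DIM('a) * exp (- \<tau>)) * indicator {0..} \<tau> * ?V"
      proof cases
        case 1
        then show ?thesis
          using emeasure_sublevel_homogeneous[OF hom 1] by (simp add: ennreal_mult mult_ac)
      next
        case 2
        have "{y. G y \<le> \<tau>} = {}" using 2 pos by (auto simp: not_le intro: less_le_trans)
        then show ?thesis using 2 by simp
      qed
    qed
  qed
  also have "\<dots> = ennreal (fact DIM('a)) * ?V"
    by (simp add: nn_integral_multc nn_intergal_power_times_exp_Ici)
  finally show ?thesis .
qed

definition supp_fun :: "'a::euclidean_space set \<Rightarrow> 'a \<Rightarrow> real" where
  "supp_fun K y = (SUP z\<in>K. y \<bullet> z)"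

lemma supp_fun_le_iff:
  assumes "bounded K" "K \<noteq> {}"
  shows "supp_fun K y \<le> a \<longleftrightarrow> (\<forall>z\<in>K. y \<bullet> z \<le> a)"
proof -
  have "bounded ((\<lambda>z. y \<bullet> z) ` K)"
    using assms(1) bounded_linear_image bounded_linear_inner_right by blast
  then have "bdd_above ((\<lambda>z. y \<bullet> z) ` K)" by (rule bounded_imp_bdd_above)
  then show ?thesis unfolding supp_fun_def using assms(2) by (rule cSUP_le_iff[rotated])
qed

lemma inner_le_supp_fun: "bounded K \<Longrightarrow> z \<in> K \<Longrightarrow> y \<bullet> z \<le> supp_fun K y"
  using supp_fun_le_iff[of K y "supp_fun K y"] by auto

lemma supp_fun_borel:
  assumes "bounded K" "K \<noteq> {}"
  shows "supp_fun K \<in> borel_measurable borel"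
proof (rule borel_measurable_iff_le[THEN iffD2], rule allI)
  fix a
  have "{w. supp_fun K w \<le> a} = (\<Inter>z\<in>K. {w. z \<bullet> w \<le> a})"
    by (auto simp: supp_fun_le_iff[OF assms] inner_commute)
  moreover have "closed (\<Inter>z\<in>K. {w. z \<bullet> w \<le> a})"
    by (intro closed_INT ballI closed_halfspace_le)
  ultimately show "{w \<in> space borel. supp_fun K w \<le> a} \<in> sets borel" by simp
qed

lemma supp_fun_scaleR:
  assumes "bounded K" "K \<noteq> {}" "0 < c"
  shows "supp_fun K (c *\<^sub>R y) = c * supp_fun K y"
proof (rule antisym)
  show "supp_fun K (c *\<^sub>R y) \<le> c * supp_fun K y"
    using assms inner_le_supp_fun[OF assms(1)] by (simp add: supp_fun_le_iff)
  have "supp_fun K y \<le> supp_fun K (c *\<^sub>R y) / c"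
    using assms inner_le_supp_fun[OF assms(1), of _ "c *\<^sub>R y"]
    by (subst supp_fun_le_iff) (simp_all add: pos_le_divide_eq mult.commute)
  then show "c * supp_fun K y \<le> supp_fun K (c *\<^sub>R y)"
    using assms by (simp add: pos_le_divide_eq mult.commute)
qed

lemma supp_fun_add:
  assumes "bounded K" "K \<noteq> {}"
  shows "supp_fun K (x + y) \<le> supp_fun K x + supp_fun K y"
  using assms inner_le_supp_fun[OF assms(1)]
  by (auto simp: supp_fun_le_iff inner_add_left intro: add_mono)

lemma supp_fun_uminus:
  assumes "K = uminus ` K"
  shows "supp_fun K (- y) = supp_fun K y"
proof -
  have "(\<lambda>z. - y \<bullet> z) ` (uminus ` K) = (\<lambda>z. y \<bullet> z) ` K" by (auto simp: image_image)
  then show ?thesis unfolding supp_fun_def using assms by metis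
qed

lemma nn_integral_exp_eq_polar:
  fixes K :: "'a::euclidean_space set"
  assumes K: "bounded K" and x: "x \<in> K"
  shows "(\<integral>\<^sup>+y. ennreal (exp (y \<bullet> x - supp_fun K y)) \<partial>lborel) =
    ennreal (fact DIM('a)) * emeasure lebesgue (polar K x)"
proof -
  have ne: "K \<noteq> {}" using x by auto
  have [measurable]: "supp_fun K \<in> borel_measurable borel" using K ne by (rule supp_fun_borel)
  let ?G = "\<lambda>y. supp_fun K y - y \<bullet> x"
  have mG: "?G \<in> borel_measurable borel" by measurable
  have "supp_fun K y - y \<bullet> x \<le> 1 \<longleftrightarrow> y \<in> polar K x" for y
    using supp_fun_le_iff[OF K ne, of y "1 + y \<bullet> x"]
    by (auto simp: polar_def inner_diff_right algebra_simps)
  then have eq: "polar K x = {y. ?G y \<le> 1}" by auto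
  have "{y \<in> space borel. ?G y \<le> 1} \<in> sets borel" using mG by measurable
  then have "{y. ?G y \<le> 1} \<in> sets borel" by simp
  then have "emeasure lebesgue (polar K x) = emeasure lborel {y. ?G y \<le> 1}" by (simp add: eq)
  moreover have "(\<integral>\<^sup>+y. ennreal (exp (- ?G y)) \<partial>lborel) =
      ennreal (fact DIM('a)) * emeasure lborel {y. ?G y \<le> 1}"
    using inner_le_supp_fun[OF K x] mG
    by (intro nn_integral_exp_homogeneous) (auto simp: supp_fun_scaleR[OF K ne] algebra_simps)
  ultimately show ?thesis by simp
qed

text \<open>
  Integrals rather than volumes of polar bodies carry the estimates, because the dependence on
  \<open>x\<close> is then explicit. The two exponentials are kept apart so that the second is a weight
  independent of \<open>x\<close>. As a Bochner integral the value is meaningful only where the polar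
  has finite volume.
\<close>
definition laplace :: "'a::euclidean_space set \<Rightarrow> 'a \<Rightarrow> real" where
  "laplace K x = (\<integral>y. exp (y \<bullet> x) * exp (- supp_fun K y) \<partial>lborel)"

lemma
  fixes K :: "'a::euclidean_space set"
  assumes K: "bounded K" and x: "x \<in> K" and fin: "emeasure lebesgue (polar K x) < \<infinity>"
  shows integrable_laplace: "integrable lborel (\<lambda>y. exp (y \<bullet> x) * exp (- supp_fun K y))"
    and laplace_eq_polar: "laplace K x = fact DIM('a) * measure lebesgue (polar K x)"
proof -
  have [measurable]: "supp_fun K \<in> borel_measurable borel" using K x by (intro supp_fun_borel) auto
  have eq: "(\<integral>\<^sup>+y. ennreal (exp (y \<bullet> x) * exp (- supp_fun K y)) \<partial>lborel) =
      ennreal (fact DIM('a)) * emeasure lebesgue (polar K x)"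
    using nn_integral_exp_eq_polar[OF K x] by (simp add: exp_add[symmetric])
  show "integrable lborel (\<lambda>y. exp (y \<bullet> x) * exp (- supp_fun K y))"
    using fin by (intro integrableI_nonneg) (auto simp: eq ennreal_mult_less_top)
  show "laplace K x = fact DIM('a) * measure lebesgue (polar K x)"
    unfolding laplace_def measure_def
    by (subst integral_eq_nn_integral) (auto simp: eq enn2real_mult)
qed

section \<open>Volumes of polar bodies and membership in the region\<close>

lemma polar_finite:
  fixes K :: "'a::euclidean_space set"
  assumes "x \<in> interior K"
  shows "emeasure lebesgue (polar K x) < \<infinity>"
proof -
  obtain r where r: "0 < r" "cball x r \<subseteq> K" using assms mem_interior_cball by blast
  have "polar K x \<subseteq> cball 0 (1 / r)"
  proof
    fix y assume y: "y \<in> polar K x"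
    show "y \<in> cball 0 (1 / r)"
    proof (cases "y = 0")
      case False
      have "x + (r / norm y) *\<^sub>R y \<in> K" using r False by (auto simp: dist_norm)
      then have "y \<bullet> ((r / norm y) *\<^sub>R y) \<le> 1" using y by (auto simp: polar_def)
      then have "norm y * r \<le> 1" using False by (simp add: dot_square_norm power2_eq_square mult.commute)
      then show ?thesis using r by (simp add: pos_le_divide_eq)
    qed (use r in simp)
  qed
  then have "emeasure lebesgue (polar K x) \<le> emeasure lebesgue (cball (0::'a) (1 / r))"
    by (rule emeasure_mono) simp
  also have "\<dots> < \<infinity>" using emeasure_lborel_cball_finite[of "0::'a" "1 / r"] by simp
  finally show ?thesis .
qed

lemma closed_polar: "closed (polar K x)"
proof -
  have "polar K x = (\<Inter>z\<in>K. {y. (z - x) \<bullet> y \<le> 1})"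
    by (auto simp: polar_def inner_commute)
  then show ?thesis by (auto intro!: closed_INT closed_halfspace_le)
qed

lemma measure_pos_of_interior:
  fixes S :: "'a::euclidean_space set"
  assumes "x \<in> interior S" "closed S" "emeasure lebesgue S < \<infinity>"
  shows "0 < measure lebesgue S"
proof -
  obtain r where r: "0 < r" "ball x r \<subseteq> S" using assms(1) mem_interior by blast
  have "0 < measure lborel (ball x r)" using r(1) by (rule content_ball_pos)
  also have "measure lborel (ball x r) = measure lebesgue (ball x r)" by simp
  also have "\<dots> \<le> measure lebesgue S"
    using r assms by (intro measure_mono_fmeasurable) (auto simp: fmeasurable_def)
  finally show ?thesis .
qed

lemma polar_zero_pos:
  fixes K :: "'a::euclidean_space set"
  assumes "bounded K" and "0 \<in> interior K"
  shows "0 < measure lebesgue (polar K 0)"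
proof (rule measure_pos_of_interior)
  obtain R where R: "0 < R" "\<And>z. z \<in> K \<Longrightarrow> norm z \<le> R" using assms(1) bounded_pos by metis
  have "ball 0 (1 / R) \<subseteq> polar K 0"
  proof
    fix y :: 'a assume "y \<in> ball 0 (1 / R)"
    then have y: "norm y \<le> 1 / R" by simp
    have "y \<bullet> z \<le> 1" if "z \<in> K" for z
    proof -
      have "y \<bullet> z \<le> norm y * norm z" by (rule norm_cauchy_schwarz)
      also have "\<dots> \<le> 1 / R * R" using y R that by (intro mult_mono) auto
      finally show ?thesis using R by simp
    qed
    then show "y \<in> polar K 0" by (simp add: polar_def)
  qed
  then show "0 \<in> interior (polar K 0)" using R(1) by (auto simp: mem_interior intro: exI[of _ "1 / R"])
qed (use polar_finite[OF assms(2)] closed_polar[of K 0] in simp_all)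

lemma convex_body_measure:
  assumes "convex_body K"
  shows "0 < measure lebesgue K" "emeasure lebesgue K = ennreal (measure lebesgue K)"
proof -
  have K: "closed K" "bounded K" and "interior K \<noteq> {}"
    using assms compact_imp_closed compact_imp_bounded by (auto simp: convex_body_def)
  then have fin: "emeasure lebesgue K < \<infinity>" using emeasure_bounded_finite[OF K(2)] by simp
  then show "0 < measure lebesgue K"
    using \<open>interior K \<noteq> {}\<close> K(1) measure_pos_of_interior by blast
  show "emeasure lebesgue K = ennreal (measure lebesgue K)"
    using fin by (intro emeasure_eq_ennreal_measure) auto
qed

text \<open>
  If the polar has infinite volume, the extended quotient is infinite and the inequality
  fails; otherwise everything can be read in the reals.
\<close>
lemma mem_santalo_region_iff:
  fixes K :: "'a::euclidean_space set"
  assumes body: "convex_body K"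
  shows "x \<in> santalo_region K t \<longleftrightarrow> x \<in> K \<and> emeasure lebesgue (polar K x) < \<infinity> \<and>
    measure lebesgue K * measure lebesgue (polar K x) / (unit_ball_volume TYPE('a))\<^sup>2 \<le> t"
proof -
  let ?v = "(unit_ball_volume TYPE('a))\<^sup>2"
  have "0 < measure lborel (cball (0::'a) 1)" by (rule content_cball_pos) simp
  then have v: "0 < ?v" by (simp add: unit_ball_volume_def)
  note m = convex_body_measure[OF body]
  show ?thesis
  proof (cases "emeasure lebesgue (polar K x) < \<infinity>")
    case True
    then have "emeasure lebesgue (polar K x) = ennreal (measure lebesgue (polar K x))"
      by (intro emeasure_eq_ennreal_measure) auto
    then have "vol_prod K x / ennreal ?v = ennreal (measure lebesgue K * measure lebesgue (polar K x) / ?v)"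
      using v by (simp add: vol_prod_def m(2) ennreal_mult[symmetric] divide_ennreal)
    then show ?thesis using True v by (simp add: santalo_region_def enn2ereal_ennreal)
  next
    case False
    then have "emeasure lebesgue (polar K x) = \<infinity>" by (simp add: not_less top_unique)
    then have "vol_prod K x = top"
      using m by (simp add: vol_prod_def ennreal_mult_top)
    then have "vol_prod K x / ennreal ?v = top" by (simp add: ennreal_top_divide)
    then show ?thesis using False by (simp add: santalo_region_def)
  qed
qed

section \<open>Weights that decay at most exponentially in one direction\<close>

text \<open>
  Translating by \<open>s u\<close> shifts \<open>y \<bullet> z\<close> by \<open>s\<close> and costs at most the factor \<open>exp (- s)\<close> in the weight:
  \<open>\<integral> f X p = \<integral> f (X + s) p (y + s u) \<ge> exp (- s) \<integral> (f X + s f' X) p\<close>. Comparing the terms of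
  first order in \<open>s\<close> gives the claim. The value of \<open>f'\<close> is a slope of a
  tangent to \<open>f\<close>, valid to the right. The conditions on \<open>f\<close> are restricted to the support of the
  weight in order that \<open>p\<close> can be cut off to a half space on which \<open>f\<close> is nonnegative.
\<close>
lemma tilt_inequality:
  fixes p :: "'a::euclidean_space \<Rightarrow> real" and f f' :: "real \<Rightarrow> real"
  assumes p0: "\<And>y. 0 \<le> p y"
    and pu: "\<And>y s. 0 \<le> s \<Longrightarrow> exp (- s) * p y \<le> p (y + s *\<^sub>R u)"
    and zu: "u \<bullet> z = 1"
    and int: "integrable lborel (\<lambda>y. f (y \<bullet> z) * p y)" "integrable lborel (\<lambda>y. f' (y \<bullet> z) * p y)"
    and f0: "\<And>y. p y > 0 \<Longrightarrow> 0 \<le> f (y \<bullet> z)"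
    and ft: "\<And>y s. p y > 0 \<Longrightarrow> 0 \<le> s \<Longrightarrow> f (y \<bullet> z) + s * f' (y \<bullet> z) \<le> f (y \<bullet> z + s)"
  shows "(\<integral>y. f' (y \<bullet> z) * p y \<partial>lborel) \<le> (\<integral>y. f (y \<bullet> z) * p y \<partial>lborel)"
proof -
  let ?A = "\<integral>y. f (y \<bullet> z) * p y \<partial>lborel" and ?B = "\<integral>y. f' (y \<bullet> z) * p y \<partial>lborel"
  have step: "?B \<le> (exp s - 1) / s * ?A" if s: "0 < s" for s
  proof -
    have transl: "?A = (\<integral>y. f ((s *\<^sub>R u + y) \<bullet> z) * p (s *\<^sub>R u + y) \<partial>lborel)"
      "integrable lborel (\<lambda>y. f ((s *\<^sub>R u + y) \<bullet> z) * p (s *\<^sub>R u + y))"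
    proof -
      have m: "(\<lambda>y. f (y \<bullet> z) * p y) \<in> borel_measurable borel"
        using borel_measurable_integrable[OF int(1)] by simp
      have t: "(+) (s *\<^sub>R u) \<in> measurable lborel borel" by measurable
      show "?A = (\<integral>y. f ((s *\<^sub>R u + y) \<bullet> z) * p (s *\<^sub>R u + y) \<partial>lborel)"
        using integral_distr[OF t m] by (simp add: lborel_distr_plus)
      show "integrable lborel (\<lambda>y. f ((s *\<^sub>R u + y) \<bullet> z) * p (s *\<^sub>R u + y))"
        using integrable_distr_eq[OF t m] int(1) by (simp add: lborel_distr_plus)
    qed
    have "(\<integral>y. exp (- s) * (f (y \<bullet> z) * p y + s * (f' (y \<bullet> z) * p y)) \<partial>lborel) \<le> ?A"
      unfolding transl(1)
    proof (rule integral_mono)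
      fix y
      have eq: "(s *\<^sub>R u + y) \<bullet> z = y \<bullet> z + s" using zu by (simp add: inner_add_left)
      show "exp (- s) * (f (y \<bullet> z) * p y + s * (f' (y \<bullet> z) * p y))
          \<le> f ((s *\<^sub>R u + y) \<bullet> z) * p (s *\<^sub>R u + y)"
      proof (cases "p y > 0")
        case True
        have pp: "exp (- s) * p y \<le> p (s *\<^sub>R u + y)" using pu[of s y] s by (simp add: add.commute)
        have "0 < exp (- s) * p y" using True by simp
        then have "p (s *\<^sub>R u + y) > 0" using pp by linarith
        then have nn: "0 \<le> f (y \<bullet> z + s)" using f0 eq by metis
        have "exp (- s) * (f (y \<bullet> z) * p y + s * (f' (y \<bullet> z) * p y))
            = (f (y \<bullet> z) + s * f' (y \<bullet> z)) * (exp (- s) * p y)" by (simp add: algebra_simps)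
        also have "\<dots> \<le> f (y \<bullet> z + s) * (exp (- s) * p y)"
          using ft[OF True, of s] s p0 by (intro mult_right_mono) auto
        also have "\<dots> \<le> f (y \<bullet> z + s) * p (s *\<^sub>R u + y)" using pp nn by (rule mult_left_mono)
        finally show ?thesis unfolding eq .
      next
        case False
        then have "p y = 0" using p0[of y] by simp
        moreover have "0 \<le> f ((s *\<^sub>R u + y) \<bullet> z) * p (s *\<^sub>R u + y)"
          using f0[of "s *\<^sub>R u + y"] p0[of "s *\<^sub>R u + y"] by (cases "p (s *\<^sub>R u + y) = 0") auto
        ultimately show ?thesis by simp
      qed
    qed (use int transl in auto)
    then have "exp (- s) * (?A + s * ?B) \<le> ?A" using int by simp
    then have "exp s * (exp (- s) * (?A + s * ?B)) \<le> exp s * ?A" by (rule mult_left_mono) simp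
    then have "?A + s * ?B \<le> exp s * ?A"
      by (simp add: mult.assoc[symmetric] exp_minus)
    then show ?thesis using s by (simp add: field_simps)
  qed
  have "((\<lambda>s::real. (exp (0 + s) - exp 0) / s) \<longlongrightarrow> 1) (at_right 0)"
    using DERIV_exp[of "0::real"] unfolding DERIV_def by (auto intro: tendsto_mono[OF at_le])
  then have "((\<lambda>s::real. (exp s - 1) / s * ?A) \<longlongrightarrow> 1 * ?A) (at_right 0)"
    by (intro tendsto_mult tendsto_const) simp
  moreover have "eventually (\<lambda>s. ?B \<le> (exp s - 1) / s * ?A) (at_right 0)"
    using step by (auto simp: eventually_at_filter)
  ultimately show ?thesis using tendsto_lowerbound[of "\<lambda>s. (exp s - 1) / s * ?A" "1 * ?A" "at_right 0" ?B]
    by (simp add: trivial_limit_at_right_real)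
qed

text \<open>
  Here \<open>d x\<close> is the point where the ray through \<open>x\<close> leaves \<open>K\<close> and \<open>u\<close> is an outer normal there,
  which pairs positively with \<open>d x\<close> since the origin is interior and can hence be normalised.
\<close>
lemma boundary_point_with_normal:
  fixes K :: "'a::euclidean_space set"
  assumes K: "bounded K" "closed K" "convex K" and "0 \<in> interior K" and "x \<noteq> 0"
  obtains d u where "0 < d" "d *\<^sub>R x \<in> K" "u \<bullet> (d *\<^sub>R x) = 1" "supp_fun K u \<le> 1"
proof -
  obtain d where d: "0 < d" "d *\<^sub>R x \<in> frontier K"
    using ray_to_frontier[OF K(1) assms(4,5)] by auto
  let ?z = "d *\<^sub>R x"
  have zK: "?z \<in> K" using d K by (auto simp: frontier_def)
  have ri: "rel_interior K = interior K" using assms(4) rel_interior_nonempty_interior by auto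
  then have "?z \<notin> rel_interior K" using d by (auto simp: frontier_def)
  then obtain a where a: "a \<noteq> 0" "\<And>y. y \<in> closure K \<Longrightarrow> a \<bullet> ?z \<le> a \<bullet> y"
      "\<And>y. y \<in> rel_interior K \<Longrightarrow> a \<bullet> ?z < a \<bullet> y"
    using supporting_hyperplane_relative_frontier[OF K(3), of ?z] zK closure_subset by blast
  have neg: "a \<bullet> ?z < 0" using a(3)[of 0] assms(4) ri by simp
  define u where "u = (1 / (a \<bullet> ?z)) *\<^sub>R a"
  have uz: "u \<bullet> ?z = 1" using less_imp_neq[OF neg] unfolding u_def inner_scaleR_left by (metis divide_self_if times_divide_eq_left mult_1)
  have "u \<bullet> y \<le> 1" if "y \<in> K" for y
    using a(2)[of y] that neg closure_subset[of K] unfolding u_def inner_scaleR_left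
    by (auto simp: neg_divide_le_eq)
  then have "supp_fun K u \<le> 1" using K zK by (subst supp_fun_le_iff) auto
  then show thesis using that d zK uz by blast
qed

lemma supp_fun_shift:
  assumes "bounded K" "K \<noteq> {}" "supp_fun K u \<le> 1" "0 \<le> s"
  shows "exp (- s) * exp (- supp_fun K y) \<le> exp (- supp_fun K (y + s *\<^sub>R u))"
proof (cases "s = 0")
  case False
  have "supp_fun K (y + s *\<^sub>R u) \<le> supp_fun K y + s * supp_fun K u"
    using supp_fun_add[OF assms(1,2), of y "s *\<^sub>R u"] supp_fun_scaleR[OF assms(1,2), of s u] False assms(4)
    by simp
  also have "\<dots> \<le> supp_fun K y + s" using assms mult_left_mono[of "supp_fun K u" 1 s] by simp
  finally show ?thesis by (simp add: exp_add[symmetric])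
qed simp

section \<open>The first moment at the Santalo point\<close>

lemma laplace_zero_le:
  assumes body: "convex_body K" and san: "is_santalo_point K 0" and x: "x \<in> interior K"
  shows "laplace K 0 \<le> laplace K x"
proof -
  have bdd: "bounded K" and int0: "0 \<in> interior K"
    using body san compact_imp_bounded by (auto simp: convex_body_def is_santalo_point_def)
  have "vol_prod K 0 \<le> vol_prod K x" using san x by (auto simp: is_santalo_point_def)
  then have "emeasure lebesgue (polar K 0) \<le> emeasure lebesgue (polar K x)"
    using convex_body_measure[OF body] by (auto simp: vol_prod_def ennreal_mult_le_mult_iff)
  then have "measure lebesgue (polar K 0) \<le> measure lebesgue (polar K x)"
    using polar_finite[OF x] by (auto simp: measure_def intro: enn2real_mono)
  then show ?thesis
    using laplace_eq_polar[OF bdd _ polar_finite[OF x]] laplace_eq_polar[OF bdd _ polar_finite[OF int0]]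
      subsetD[OF interior_subset int0] subsetD[OF interior_subset x] by simp
qed

text \<open>
  The factor \<open>exp \<bar>w\<bar>\<close> makes the quadratic remainder valid on the whole line; it is harmless
  against the weight \<open>exp (- h)\<close> as long as the exponent is small.
\<close>
lemma exp_le_quadratic: "exp w - 1 \<le> w + w\<^sup>2 * exp \<bar>w\<bar>" for w :: real
proof -
  have "1 - w \<le> exp (- w)" using exp_ge_add_one_self[of "- w"] by simp
  then have "exp w * (1 - w) \<le> exp w * exp (- w)" by (rule mult_left_mono) simp
  then have a: "exp w - 1 \<le> w * exp w" by (simp add: exp_minus algebra_simps)
  have "w * (exp w - 1) \<le> w\<^sup>2 * exp \<bar>w\<bar>"
  proof (cases "0 \<le> w")
    case True
    then have "w * (exp w - 1) \<le> w * (w * exp w)" using a by (intro mult_left_mono)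
    then show ?thesis using True by (simp add: power2_eq_square)
  next
    case False
    then have "w * (exp w - 1) \<le> w * w"
      using exp_ge_add_one_self[of w] by (intro mult_left_mono_neg) linarith+
    also have "\<dots> \<le> w\<^sup>2 * exp \<bar>w\<bar>" by (simp add: power2_eq_square mult_le_cancel_left1 not_less)
    finally show ?thesis .
  qed
  then show ?thesis using a by (simp add: algebra_simps)
qed

text \<open>
  The first moment is the derivative at 0 of \<open>\<epsilon> \<mapsto> laplace K (\<epsilon> z)\<close>, which is nonnegative because
  the origin minimises the transform over the interior. Instead of differentiating under the
  integral, the increment is bounded above by \<open>\<epsilon>\<close> times the moment plus a multiple of \<open>\<epsilon>\<^sup>2\<close>. All
  integrands are dominated by a multiple of \<open>exp (\<delta> \<bar>y \<bullet> z\<bar>) exp (- h y)\<close>, which is integrable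
  because both \<open>\<delta> z\<close> and \<open>- \<delta> z\<close> are interior to \<open>K\<close>.
\<close>
lemma first_moment:
  fixes K :: "'a::euclidean_space set"
  assumes body: "convex_body K" and san: "is_santalo_point K 0"
  shows "integrable lborel (\<lambda>y. (y \<bullet> z) * exp (- supp_fun K y))" (is ?I)
    and "0 \<le> (\<integral>y. (y \<bullet> z) * exp (- supp_fun K y) \<partial>lborel)" (is ?P)
proof -
  let ?p = "\<lambda>y. exp (- supp_fun K y)"
  have K: "compact K" "closed K" "bounded K" and int0: "0 \<in> interior K"
    using body san compact_imp_closed compact_imp_bounded by (auto simp: convex_body_def is_santalo_point_def)
  have ne: "K \<noteq> {}" using int0 interior_subset by auto
  have [measurable]: "supp_fun K \<in> borel_measurable borel" using K(3) ne by (rule supp_fun_borel)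
  obtain r where r: "0 < r" "ball 0 r \<subseteq> K" using int0 mem_interior by blast
  have "ball 0 r \<subseteq> interior K" using r(2) by (simp add: interior_maximal)
  define \<delta> where "\<delta> = r / (1 + norm z)"
  have \<delta>: "0 < \<delta>" using r(1) by (simp add: \<delta>_def add_pos_nonneg)
  have inside: "c *\<^sub>R z \<in> interior K" if "\<bar>c\<bar> \<le> \<delta>" for c
  proof -
    have "\<bar>c\<bar> * norm z \<le> \<delta> * norm z" using that by (rule mult_right_mono) simp
    also have "\<dots> < \<delta> * (1 + norm z)" using \<delta> by (simp add: distrib_left)
    also have "\<dots> = r" by (simp add: \<delta>_def add_nonneg_eq_0_iff)
    finally show ?thesis using \<open>ball 0 r \<subseteq> interior K\<close> by auto
  qed
  have int_exp: "integrable lborel (\<lambda>y. exp (c * (y \<bullet> z)) * ?p y)" if "\<bar>c\<bar> \<le> \<delta>" for c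
    using integrable_laplace[OF K(3) _ polar_finite[OF inside[OF that]]] inside[OF that] interior_subset
    by auto
  let ?R = "\<lambda>y. exp (\<delta> * (y \<bullet> z)) * ?p y + exp ((- \<delta>) * (y \<bullet> z)) * ?p y"
  have intR: "integrable lborel ?R" using \<delta> by (intro Bochner_Integration.integrable_add int_exp) auto
  have absR: "exp (\<delta> * \<bar>y \<bullet> z\<bar>) * ?p y \<le> ?R y" for y
    by (cases "0 \<le> y \<bullet> z") auto
  show int1: ?I
  proof (rule Bochner_Integration.integrable_bound)
    show "integrable lborel (\<lambda>y. (1 / \<delta>) * ?R y)" using intR by (rule integrable_mult_right)
    show "AE y in lborel. norm ((y \<bullet> z) * ?p y) \<le> norm ((1 / \<delta>) * ?R y)"
    proof (rule AE_I2)
      fix y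
      have "\<delta> * \<bar>y \<bullet> z\<bar> \<le> exp (\<delta> * \<bar>y \<bullet> z\<bar>)" using exp_ge_add_one_self[of "\<delta> * \<bar>y \<bullet> z\<bar>"] by linarith
      then have "\<bar>y \<bullet> z\<bar> * ?p y \<le> (1 / \<delta>) * (exp (\<delta> * \<bar>y \<bullet> z\<bar>) * ?p y)"
        using \<delta> by (simp add: field_simps)
      also have "\<dots> \<le> (1 / \<delta>) * ?R y" using absR[of y] \<delta> by (intro mult_left_mono) auto
      also have "\<dots> \<le> norm ((1 / \<delta>) * ?R y)" unfolding real_norm_def by (rule abs_ge_self)
      finally show "norm ((y \<bullet> z) * ?p y) \<le> norm ((1 / \<delta>) * ?R y)" by (simp add: abs_mult)
    qed
  qed measurable
  \<comment> \<open>The 8 comes from \<open>(\<delta> X / 2)\<^sup>2 \<le> 2 exp (\<delta> \<bar>X\<bar> / 2)\<close>: half of \<open>\<delta>\<close> absorbs the square \<open>X\<^sup>2\<close>,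
    the other half the remainder factor \<open>exp \<bar>\<epsilon> X\<bar>\<close>.\<close>
  define C where "C = 8 / \<delta>\<^sup>2 * (\<integral>y. ?R y \<partial>lborel)"
  have lower: "0 \<le> (\<integral>y. (y \<bullet> z) * ?p y \<partial>lborel) + \<epsilon> * C" if \<epsilon>: "0 < \<epsilon>" "\<epsilon> \<le> \<delta> / 2" for \<epsilon>
  proof -
    have e\<delta>: "\<bar>\<epsilon>\<bar> \<le> \<delta>" "\<bar>0\<bar> \<le> \<delta>" using \<epsilon> \<delta> by auto
    have in\<epsilon>: "\<epsilon> *\<^sub>R z \<in> interior K" using inside e\<delta> by blast
    have i0: "integrable lborel ?p" using int_exp[OF e\<delta>(2)] by simp
    have i1: "integrable lborel (\<lambda>y. \<epsilon> * ((y \<bullet> z) * ?p y))" using int1 by (rule integrable_mult_right)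
    have i2: "integrable lborel (\<lambda>y. \<epsilon>\<^sup>2 * (8 / \<delta>\<^sup>2 * ?R y))" using intR by (intro integrable_mult_right)
    have "laplace K 0 \<le> laplace K (\<epsilon> *\<^sub>R z)"
      using laplace_zero_le[OF body san in\<epsilon>] .
    then have "(\<integral>y. ?p y \<partial>lborel) \<le> (\<integral>y. exp (\<epsilon> * (y \<bullet> z)) * ?p y \<partial>lborel)"
      by (simp add: laplace_def)
    also have "\<dots> \<le> (\<integral>y. ?p y + (\<epsilon> * ((y \<bullet> z) * ?p y) + \<epsilon>\<^sup>2 * (8 / \<delta>\<^sup>2 * ?R y)) \<partial>lborel)"
    proof (rule integral_mono)
      fix y
      define X where "X = y \<bullet> z"
      have "(\<delta> / 2 * \<bar>X\<bar>)\<^sup>2 \<le> 2 * exp (\<delta> / 2 * \<bar>X\<bar>)"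
        using exp_lower_Taylor_quadratic[of "\<delta> / 2 * \<bar>X\<bar>"] mult_nonneg_nonneg[of "\<delta> / 2" "\<bar>X\<bar>"] \<delta>
        by linarith
      then have sq: "X\<^sup>2 \<le> 8 / \<delta>\<^sup>2 * exp (\<delta> / 2 * \<bar>X\<bar>)"
        using \<delta> by (simp add: power_mult_distrib power_divide field_simps)
      have "exp (\<epsilon> * X) \<le> 1 + \<epsilon> * X + (\<epsilon> * X)\<^sup>2 * exp \<bar>\<epsilon> * X\<bar>"
        using exp_le_quadratic[of "\<epsilon> * X"] by simp
      also have "(\<epsilon> * X)\<^sup>2 * exp \<bar>\<epsilon> * X\<bar> \<le> (\<epsilon>\<^sup>2 * (8 / \<delta>\<^sup>2 * exp (\<delta> / 2 * \<bar>X\<bar>))) * exp (\<delta> / 2 * \<bar>X\<bar>)"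
      proof (rule mult_mono)
        show "(\<epsilon> * X)\<^sup>2 \<le> \<epsilon>\<^sup>2 * (8 / \<delta>\<^sup>2 * exp (\<delta> / 2 * \<bar>X\<bar>))"
          unfolding power_mult_distrib using sq by (rule mult_left_mono) simp
        have "\<bar>\<epsilon> * X\<bar> \<le> \<delta> / 2 * \<bar>X\<bar>"
          unfolding abs_mult using \<epsilon> by (intro mult_right_mono) auto
        then show "exp \<bar>\<epsilon> * X\<bar> \<le> exp (\<delta> / 2 * \<bar>X\<bar>)" by simp
      qed auto
      also have "\<dots> = \<epsilon>\<^sup>2 * (8 / \<delta>\<^sup>2 * exp (\<delta> * \<bar>X\<bar>))" by (simp add: mult_exp_exp)
      finally have "exp (\<epsilon> * X) \<le> 1 + \<epsilon> * X + \<epsilon>\<^sup>2 * (8 / \<delta>\<^sup>2 * exp (\<delta> * \<bar>X\<bar>))" by simp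
      then have "exp (\<epsilon> * X) * ?p y \<le> (1 + \<epsilon> * X + \<epsilon>\<^sup>2 * (8 / \<delta>\<^sup>2 * exp (\<delta> * \<bar>X\<bar>))) * ?p y"
        by (rule mult_right_mono) simp
      also have "\<dots> = ?p y + (\<epsilon> * (X * ?p y) + \<epsilon>\<^sup>2 * (8 / \<delta>\<^sup>2 * (exp (\<delta> * \<bar>X\<bar>) * ?p y)))"
        by (simp add: distrib_right mult.assoc)
      also have "\<dots> \<le> ?p y + (\<epsilon> * (X * ?p y) + \<epsilon>\<^sup>2 * (8 / \<delta>\<^sup>2 * ?R y))"
        using absR[of y] unfolding X_def by (intro add_left_mono mult_left_mono) auto
      finally show "exp (\<epsilon> * (y \<bullet> z)) * ?p y \<le> ?p y + (\<epsilon> * ((y \<bullet> z) * ?p y) + \<epsilon>\<^sup>2 * (8 / \<delta>\<^sup>2 * ?R y))"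
        unfolding X_def .
    qed (intro int_exp[OF e\<delta>(1)] Bochner_Integration.integrable_add i0 i1 i2)+
    also have "\<dots> = (\<integral>y. ?p y \<partial>lborel) + (\<epsilon> * (\<integral>y. (y \<bullet> z) * ?p y \<partial>lborel) + \<epsilon>\<^sup>2 * C)"
      by (subst Bochner_Integration.integral_add[OF i0 Bochner_Integration.integrable_add[OF i1 i2]],
          subst Bochner_Integration.integral_add[OF i1 i2])
        (simp only: C_def integral_mult_right_zero)
    finally have "0 \<le> \<epsilon> * ((\<integral>y. (y \<bullet> z) * ?p y \<partial>lborel) + \<epsilon> * C)"
      by (simp add: distrib_left power2_eq_square mult.assoc)
    then show ?thesis using \<epsilon>(1) by (simp add: zero_le_mult_iff)
  qed
  show ?P
  proof (rule tendsto_lowerbound)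
    let ?m = "\<integral>y. (y \<bullet> z) * ?p y \<partial>lborel"
    have "((\<lambda>\<epsilon>. ?m + \<epsilon> * C) \<longlongrightarrow> ?m + 0 * C) (at_right 0)" by (intro tendsto_intros)
    then show "((\<lambda>\<epsilon>. ?m + \<epsilon> * C) \<longlongrightarrow> ?m) (at_right 0)" by simp
    have "eventually (\<lambda>\<epsilon>. \<epsilon> \<in> {0<..<\<delta> / 2}) (at_right 0)"
      using \<delta> by (intro eventually_at_right_real) simp
    then show "eventually (\<lambda>\<epsilon>. 0 \<le> ?m + \<epsilon> * C) (at_right 0)"
      by eventually_elim (use lower in auto)
  qed simp
qed

section \<open>Lower bounds for the Laplace transform\<close>

text \<open>
  The test function \<open>f\<close> is \<open>exp (\<rho> r)\<close> minus its tangent at \<open>r = -1\<close>, the left endpoint of the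
  extremal exponential law: it is convex, nonnegative, and vanishes there to second order. In
  \<open>f - f'\<close> the exponential acquires the factor \<open>1 - \<rho>\<close>, the constant terms collapse to
  \<open>exp (- \<rho>)\<close>, and the linear term is controlled by the sign of the first moment.
\<close>
lemma laplace_lower_bound:
  fixes K :: "'a::euclidean_space set"
  assumes body: "convex_body K" and san: "is_santalo_point K 0"
    and u: "u \<bullet> z = 1" "supp_fun K u \<le> 1" and \<rho>: "0 \<le> \<rho>"
    and lzK: "\<rho> *\<^sub>R z \<in> K" and fin: "emeasure lebesgue (polar K (\<rho> *\<^sub>R z)) < \<infinity>"
  shows "exp (- \<rho>) * laplace K 0 \<le> (1 - \<rho>) * laplace K (\<rho> *\<^sub>R z)"
proof -
  let ?p = "\<lambda>y. exp (- supp_fun K y)"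
  let ?m = "\<integral>y. (y \<bullet> z) * ?p y \<partial>lborel"
  have bdd: "bounded K" and ne: "K \<noteq> {}" and int0: "0 \<in> interior K"
    using body san compact_imp_bounded by (auto simp: convex_body_def is_santalo_point_def)
  have i0: "integrable lborel ?p"
    using integrable_laplace[OF bdd _ polar_finite[OF int0]] int0 interior_subset by auto
  have i1: "integrable lborel (\<lambda>y. (y \<bullet> z) * ?p y)" and m: "0 \<le> ?m"
    using first_moment[OF body san] by auto
  have i2: "integrable lborel (\<lambda>y. exp (\<rho> * (y \<bullet> z)) * ?p y)"
    using integrable_laplace[OF bdd lzK fin] by simp
  have L: "laplace K (\<rho> *\<^sub>R z) = (\<integral>y. exp (\<rho> * (y \<bullet> z)) * ?p y \<partial>lborel)" "laplace K 0 = (\<integral>y. ?p y \<partial>lborel)"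
    by (simp_all add: laplace_def)
  define f where "f r = exp (\<rho> * r) - exp (- \<rho>) * (1 + \<rho> + \<rho> * r)" for r
  define f' where "f' r = \<rho> * exp (\<rho> * r) - exp (- \<rho>) * \<rho>" for r
  have fp: "f (y \<bullet> z) * ?p y = exp (\<rho> * (y \<bullet> z)) * ?p y
      - (exp (- \<rho>) * (1 + \<rho>) * ?p y + exp (- \<rho>) * \<rho> * ((y \<bullet> z) * ?p y))" for y
    by (simp add: f_def algebra_simps)
  have f'p: "f' (y \<bullet> z) * ?p y = \<rho> * (exp (\<rho> * (y \<bullet> z)) * ?p y) - exp (- \<rho>) * \<rho> * ?p y" for y
    by (simp add: f'_def algebra_simps)
  have "(\<integral>y. f' (y \<bullet> z) * ?p y \<partial>lborel) \<le> (\<integral>y. f (y \<bullet> z) * ?p y \<partial>lborel)"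
  proof (rule tilt_inequality[where u = u])
    show "exp (- s) * ?p y \<le> ?p (y + s *\<^sub>R u)" if "0 \<le> s" for y s
      using supp_fun_shift[OF bdd ne u(2) that] .
    show "integrable lborel (\<lambda>y. f (y \<bullet> z) * ?p y)"
      unfolding fp by (intro Bochner_Integration.integrable_diff Bochner_Integration.integrable_add integrable_mult_right i0 i1 i2)
    show "integrable lborel (\<lambda>y. f' (y \<bullet> z) * ?p y)"
      unfolding f'p by (intro Bochner_Integration.integrable_diff integrable_mult_right i0 i2)
    show "0 \<le> f (y \<bullet> z)" for y
    proof -
      have "1 + (\<rho> + \<rho> * (y \<bullet> z)) \<le> exp (\<rho> + \<rho> * (y \<bullet> z))" by (rule exp_ge_add_one_self)
      then have "exp (- \<rho>) * (1 + (\<rho> + \<rho> * (y \<bullet> z))) \<le> exp (- \<rho>) * exp (\<rho> + \<rho> * (y \<bullet> z))"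
        by (rule mult_left_mono) simp
      then show ?thesis by (simp add: f_def mult_exp_exp add.assoc)
    qed
    show "f (y \<bullet> z) + s * f' (y \<bullet> z) \<le> f (y \<bullet> z + s)" for y s
    proof -
      have "exp (\<rho> * (y \<bullet> z)) * (1 + \<rho> * s) \<le> exp (\<rho> * (y \<bullet> z)) * exp (\<rho> * s)"
        using exp_ge_add_one_self[of "\<rho> * s"] by (intro mult_left_mono) auto
      then show ?thesis by (simp add: f_def f'_def exp_add[symmetric] algebra_simps)
    qed
  qed (use u in auto)
  moreover have "(\<integral>y. f (y \<bullet> z) * ?p y \<partial>lborel) =
      laplace K (\<rho> *\<^sub>R z) - (exp (- \<rho>) * (1 + \<rho>) * laplace K 0 + exp (- \<rho>) * \<rho> * ?m)"
    unfolding fp L using i0 i1 i2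
    by (subst Bochner_Integration.integral_diff; (subst Bochner_Integration.integral_add)?)
      (auto simp del: mult_minus_left intro!: Bochner_Integration.integrable_add integrable_mult_right)
  moreover have "(\<integral>y. f' (y \<bullet> z) * ?p y \<partial>lborel) = \<rho> * laplace K (\<rho> *\<^sub>R z) - exp (- \<rho>) * \<rho> * laplace K 0"
    unfolding f'p L using i0 i2 by (subst Bochner_Integration.integral_diff) auto
  moreover have "0 \<le> exp (- \<rho>) * \<rho> * ?m" using \<rho> m by simp
  ultimately show ?thesis by (simp add: algebra_simps)
qed

lemma
  fixes f :: "'a::euclidean_space \<Rightarrow> real"
  assumes "f \<in> borel_measurable borel"
  shows integral_uminus_euclidean: "(\<integral>y. f (- y) \<partial>lborel) = (\<integral>y. f y \<partial>lborel)"
    and integrable_uminus_euclidean: "integrable lborel (\<lambda>y. f (- y)) \<longleftrightarrow> integrable lborel f"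
proof -
  have "(lborel :: 'a measure) = density (distr lborel borel (\<lambda>x. 0 + (- 1) *\<^sub>R x)) (\<lambda>_. ennreal (\<bar>- 1\<bar> ^ DIM('a)))"
    by (rule lborel_affine) simp
  then have d: "distr lborel borel uminus = (lborel :: 'a measure)"
    by (simp add: density_1 scaleR_minus1_left)
  have t: "(uminus :: 'a \<Rightarrow> 'a) \<in> measurable lborel borel" by measurable
  show "(\<integral>y. f (- y) \<partial>lborel) = (\<integral>y. f y \<partial>lborel)"
    using integral_distr[OF t assms] by (simp add: d)
  show "integrable lborel (\<lambda>y. f (- y)) \<longleftrightarrow> integrable lborel f"
    using integrable_distr_eq[OF t assms] by (simp add: d)
qed

text \<open>
  The value at 0 makes \<open>half_step r + half_step (- r) = 1\<close> hold everywhere, so that even integrands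
  split exactly in half, the hyperplane between the two half spaces included.
\<close>
definition half_step :: "real \<Rightarrow> real" where
  "half_step r = (if 0 < r then 1 else if r = 0 then 1 / 2 else 0)"

lemma half_step_borel [measurable]: "half_step \<in> borel_measurable borel"
  unfolding half_step_def[abs_def] by measurable

lemma half_step_bounds: "0 \<le> half_step r" "half_step r \<le> 1"
  by (auto simp: half_step_def)

lemma integrable_half_step:
  fixes g :: "'a::euclidean_space \<Rightarrow> real"
  assumes g: "integrable lborel g"
  shows "integrable lborel (\<lambda>y. half_step (y \<bullet> z) * g y)"
proof (rule Bochner_Integration.integrable_bound[OF g])
  have [measurable]: "g \<in> borel_measurable borel" using borel_measurable_integrable[OF g] by simp
  show "(\<lambda>y. half_step (y \<bullet> z) * g y) \<in> borel_measurable lborel" by measurable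
  show "AE y in lborel. norm (half_step (y \<bullet> z) * g y) \<le> norm (g y)"
    using half_step_bounds by (auto simp: abs_mult intro!: mult_left_le_one_le)
qed

lemma integral_half_step_even:
  fixes g :: "'a::euclidean_space \<Rightarrow> real"
  assumes g: "integrable lborel g" and even: "\<And>y. g (- y) = g y"
  shows "2 * (\<integral>y. half_step (y \<bullet> z) * g y \<partial>lborel) = (\<integral>y. g y \<partial>lborel)"
proof -
  have [measurable]: "g \<in> borel_measurable borel" using borel_measurable_integrable[OF g] by simp
  let ?h = "\<lambda>y. half_step (y \<bullet> z) * g y"
  have int: "integrable lborel ?h" by (rule integrable_half_step[OF g])
  have m: "?h \<in> borel_measurable borel" by measurable
  have int': "integrable lborel (\<lambda>y. ?h (- y))" using integrable_uminus_euclidean[OF m] int by simp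
  have "2 * (\<integral>y. ?h y \<partial>lborel) = (\<integral>y. ?h y \<partial>lborel) + (\<integral>y. ?h (- y) \<partial>lborel)"
    by (subst integral_uminus_euclidean[OF m]) simp
  also have "\<dots> = (\<integral>y. ?h y + ?h (- y) \<partial>lborel)"
    by (rule Bochner_Integration.integral_add[OF int int', symmetric])
  also have "\<dots> = (\<integral>y. g y \<partial>lborel)"
    by (rule Bochner_Integration.integral_cong) (auto simp: half_step_def even)
  finally show "2 * (\<integral>y. ?h y \<partial>lborel) = (\<integral>y. g y \<partial>lborel)" .
qed

text \<open>
  The weight is even, so only the half space \<open>y \<bullet> z \<ge> 0\<close> matters; cutting off to it keeps the decay
  condition because \<open>u\<close> points into it. By evenness the transform is the integral of
  \<open>cosh (\<rho> X)\<close>. The test function \<open>f r = cosh (\<rho> r) + \<rho> sinh (\<rho> r) - 1\<close> is the solution of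
  \<open>f - f' = (1 - \<rho>\<^sup>2) cosh (\<rho> r) - 1\<close> with \<open>f 0 = 0\<close>; on the half line it is nonnegative, and it is
  convex since \<open>\<rho> \<le> 1\<close>.
\<close>
lemma laplace_lower_bound_symmetric:
  fixes K :: "'a::euclidean_space set"
  assumes bdd: "bounded K" and int0: "0 \<in> interior K" and sym: "K = uminus ` K"
    and u: "u \<bullet> z = 1" "supp_fun K u \<le> 1" and \<rho>: "0 \<le> \<rho>" "\<rho> \<le> 1"
    and lzK: "\<rho> *\<^sub>R z \<in> K" and fin: "emeasure lebesgue (polar K (\<rho> *\<^sub>R z)) < \<infinity>"
  shows "laplace K 0 \<le> (1 - \<rho>\<^sup>2) * laplace K (\<rho> *\<^sub>R z)"
proof -
  let ?p = "\<lambda>y. exp (- supp_fun K y)" and ?q = "\<lambda>y. half_step (y \<bullet> z) * exp (- supp_fun K y)"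
  have ne: "K \<noteq> {}" using lzK by auto
  have [measurable]: "supp_fun K \<in> borel_measurable borel" using bdd ne by (rule supp_fun_borel)
  have even: "?p (- y) = ?p y" for y using supp_fun_uminus[OF sym] by simp
  have i0: "integrable lborel ?p"
    using integrable_laplace[OF bdd _ polar_finite[OF int0]] int0 interior_subset by auto
  have ip: "integrable lborel (\<lambda>y. exp (\<rho> * (y \<bullet> z)) * ?p y)"
    using integrable_laplace[OF bdd lzK fin] by simp
  have mp: "(\<lambda>y. exp (\<rho> * (y \<bullet> z)) * ?p y) \<in> borel_measurable borel" by measurable
  have im: "integrable lborel (\<lambda>y. exp (- (\<rho> * (y \<bullet> z))) * ?p y)"
    using integrable_uminus_euclidean[OF mp] ip by (simp add: supp_fun_uminus[OF sym])
  have ic: "integrable lborel (\<lambda>y. cosh (\<rho> * (y \<bullet> z)) * ?p y)"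
    and ish: "integrable lborel (\<lambda>y. sinh (\<rho> * (y \<bullet> z)) * ?p y)"
    using ip im by (simp_all add: cosh_field_def sinh_field_def add_divide_distrib diff_divide_distrib
        distrib_right left_diff_distrib)
  have Lc: "laplace K (\<rho> *\<^sub>R z) = (\<integral>y. cosh (\<rho> * (y \<bullet> z)) * ?p y \<partial>lborel)"
  proof -
    have "(\<integral>y. cosh (\<rho> * (y \<bullet> z)) * ?p y \<partial>lborel) =
        (\<integral>y. (1 / 2) * (exp (\<rho> * (y \<bullet> z)) * ?p y) + (1 / 2) * (exp (- (\<rho> * (y \<bullet> z))) * ?p y) \<partial>lborel)"
      by (rule Bochner_Integration.integral_cong) (auto simp: cosh_field_def algebra_simps add_divide_distrib)
    also have "\<dots> = (1 / 2) * (\<integral>y. exp (\<rho> * (y \<bullet> z)) * ?p y \<partial>lborel)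
        + (1 / 2) * (\<integral>y. exp (- (\<rho> * (y \<bullet> z))) * ?p y \<partial>lborel)"
      using ip im by (subst Bochner_Integration.integral_add) auto
    also have "(\<integral>y. exp (- (\<rho> * (y \<bullet> z))) * ?p y \<partial>lborel) = (\<integral>y. exp (\<rho> * (y \<bullet> z)) * ?p y \<partial>lborel)"
      using integral_uminus_euclidean[OF mp] by (simp add: supp_fun_uminus[OF sym])
    finally show ?thesis by (simp add: laplace_def)
  qed
  have L0: "laplace K 0 = (\<integral>y. ?p y \<partial>lborel)" by (simp add: laplace_def)
  have halfc: "2 * (\<integral>y. cosh (\<rho> * (y \<bullet> z)) * ?q y \<partial>lborel) = laplace K (\<rho> *\<^sub>R z)"
    and iqc: "integrable lborel (\<lambda>y. cosh (\<rho> * (y \<bullet> z)) * ?q y)"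
    using integral_half_step_even[OF ic, of z] integrable_half_step[OF ic, of z] even by (simp_all add: Lc mult_ac)
  have half0: "2 * (\<integral>y. ?q y \<partial>lborel) = laplace K 0" and iq0: "integrable lborel ?q"
    using integral_half_step_even[OF i0, of z] integrable_half_step[OF i0, of z] even by (simp_all add: L0)
  have iqs: "integrable lborel (\<lambda>y. sinh (\<rho> * (y \<bullet> z)) * ?q y)"
    using integrable_half_step[OF ish, of z] by (simp only: mult.left_commute)
  define f where "f r = cosh (\<rho> * r) + \<rho> * sinh (\<rho> * r) - 1" for r
  define f' where "f' r = \<rho> * sinh (\<rho> * r) + \<rho>\<^sup>2 * cosh (\<rho> * r)" for r
  have fq: "f (y \<bullet> z) * ?q y = cosh (\<rho> * (y \<bullet> z)) * ?q y
      + (\<rho> * (sinh (\<rho> * (y \<bullet> z)) * ?q y) - ?q y)" for y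
    by (simp add: f_def algebra_simps)
  have f'q: "f' (y \<bullet> z) * ?q y = \<rho> * (sinh (\<rho> * (y \<bullet> z)) * ?q y)
      + \<rho>\<^sup>2 * (cosh (\<rho> * (y \<bullet> z)) * ?q y)" for y
    by (simp add: f'_def algebra_simps)
  have "(\<integral>y. f' (y \<bullet> z) * ?q y \<partial>lborel) \<le> (\<integral>y. f (y \<bullet> z) * ?q y \<partial>lborel)"
  proof (rule tilt_inequality[where u = u])
    show "0 \<le> ?q y" for y using half_step_bounds by simp
    show "exp (- s) * ?q y \<le> ?q (y + s *\<^sub>R u)" if s: "0 \<le> s" for y s
    proof -
      have "half_step (y \<bullet> z) \<le> half_step ((y + s *\<^sub>R u) \<bullet> z)"
        using u(1) s by (auto simp: half_step_def inner_add_left)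
      then have "half_step (y \<bullet> z) * (exp (- s) * ?p y) \<le> half_step ((y + s *\<^sub>R u) \<bullet> z) * ?p (y + s *\<^sub>R u)"
        using supp_fun_shift[OF bdd ne u(2) s, of y] half_step_bounds by (intro mult_mono) auto
      then show ?thesis by (simp only: mult.left_commute)
    qed
    show "integrable lborel (\<lambda>y. f (y \<bullet> z) * ?q y)"
      unfolding fq by (intro Bochner_Integration.integrable_diff Bochner_Integration.integrable_add integrable_mult_right iq0 iqc iqs)
    show "integrable lborel (\<lambda>y. f' (y \<bullet> z) * ?q y)"
      unfolding f'q by (intro Bochner_Integration.integrable_add integrable_mult_right iqc iqs)
    show "0 \<le> f (y \<bullet> z)" if "0 < ?q y" for y
    proof -
      have "0 \<le> y \<bullet> z" using that by (auto simp: half_step_def split: if_splits)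
      then have "0 \<le> \<rho> * sinh (\<rho> * (y \<bullet> z))" using \<rho> by simp
      then show ?thesis using \<rho> cosh_real_ge_1[of "\<rho> * (y \<bullet> z)"] by (simp add: f_def)
    qed
    show "f (y \<bullet> z) + s * f' (y \<bullet> z) \<le> f (y \<bullet> z + s)" for y s
    proof -
      define X where "X = y \<bullet> z"
      \<comment> \<open>Both coefficients are nonnegative, so the tangent inequality for \<open>f\<close> is a combination of
        those for the two exponentials.\<close>
      have f: "f r = (1 + \<rho>) / 2 * exp (\<rho> * r) + (1 - \<rho>) / 2 * exp (- (\<rho> * r)) - 1" for r
        by (simp add: f_def cosh_field_def sinh_field_def field_simps)
      have f': "f' r = (1 + \<rho>) / 2 * (\<rho> * exp (\<rho> * r)) - (1 - \<rho>) / 2 * (\<rho> * exp (- (\<rho> * r)))" for r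
        by (simp add: f'_def cosh_field_def sinh_field_def field_simps power2_eq_square)
      have a: "exp (\<rho> * X) * (1 + \<rho> * s) \<le> exp (\<rho> * (X + s))"
        using mult_left_mono[OF exp_ge_add_one_self[of "\<rho> * s"], of "exp (\<rho> * X)"]
        by (simp add: distrib_left mult_exp_exp)
      have b: "exp (- (\<rho> * X)) * (1 - \<rho> * s) \<le> exp (- (\<rho> * (X + s)))"
        using mult_left_mono[OF exp_ge_add_one_self[of "- (\<rho> * s)"], of "exp (- (\<rho> * X))"]
        by (simp add: distrib_left mult_exp_exp)
      have "(1 + \<rho>) / 2 * (exp (\<rho> * X) * (1 + \<rho> * s)) + (1 - \<rho>) / 2 * (exp (- (\<rho> * X)) * (1 - \<rho> * s))
          \<le> (1 + \<rho>) / 2 * exp (\<rho> * (X + s)) + (1 - \<rho>) / 2 * exp (- (\<rho> * (X + s)))"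
        using \<rho> a b by (intro add_mono mult_left_mono) auto
      moreover have "f X + s * f' X = (1 + \<rho>) / 2 * (exp (\<rho> * X) * (1 + \<rho> * s))
          + (1 - \<rho>) / 2 * (exp (- (\<rho> * X)) * (1 - \<rho> * s)) - 1"
        unfolding f f' by algebra
      ultimately show ?thesis unfolding X_def[symmetric] f[of "X + s"] by linarith
    qed
  qed (use u in auto)
  moreover have "(\<integral>y. f (y \<bullet> z) * ?q y \<partial>lborel) = (\<integral>y. cosh (\<rho> * (y \<bullet> z)) * ?q y \<partial>lborel)
      + (\<rho> * (\<integral>y. sinh (\<rho> * (y \<bullet> z)) * ?q y \<partial>lborel) - (\<integral>y. ?q y \<partial>lborel))"
    unfolding fq using iq0 iqc iqs
    by (subst Bochner_Integration.integral_add; (subst Bochner_Integration.integral_diff)?) auto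
  moreover have "(\<integral>y. f' (y \<bullet> z) * ?q y \<partial>lborel) = \<rho> * (\<integral>y. sinh (\<rho> * (y \<bullet> z)) * ?q y \<partial>lborel)
      + \<rho>\<^sup>2 * (\<integral>y. cosh (\<rho> * (y \<bullet> z)) * ?q y \<partial>lborel)"
    unfolding f'q using iqc iqs by (subst Bochner_Integration.integral_add) auto
  ultimately have "(\<integral>y. ?q y \<partial>lborel) \<le> (1 - \<rho>\<^sup>2) * (\<integral>y. cosh (\<rho> * (y \<bullet> z)) * ?q y \<partial>lborel)"
    by (simp add: left_diff_distrib)
  then show ?thesis unfolding halfc[symmetric] half0[symmetric] by simp
qed

section \<open>The inclusions\<close>

text \<open>
  The number \<open>\<rho>\<close> is the gauge of \<open>x\<close>, and the two last bounds are the transform bounds with the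
  factors common to both base points restored. That \<open>\<rho> < 1\<close>, i.e. that \<open>x\<close> is not on the boundary, follows
  from the first transform bound, whose right-hand side vanishes at \<open>\<rho> = 1\<close>. Interiority then
  makes the minimality at the origin applicable to \<open>x\<close>.
\<close>
lemma santalo_region_radial_bound:
  fixes K :: "'a::euclidean_space set"
  assumes body: "convex_body K" and san: "is_santalo_point K 0" and x: "x \<in> santalo_region K t"
  obtains \<rho> z where "z \<in> K" "x = \<rho> *\<^sub>R z" "0 \<le> \<rho>" "\<rho> < 1" "santalo_ratio K \<le> t"
    "exp (- \<rho>) * santalo_ratio K \<le> (1 - \<rho>) * t"
    "K = uminus ` K \<Longrightarrow> santalo_ratio K \<le> (1 - \<rho>\<^sup>2) * t"
proof (cases "x = 0")
  case True
  have "santalo_ratio K \<le> t"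
    using x unfolding mem_santalo_region_iff[OF body] True santalo_ratio_def by simp
  then show ?thesis using that[of 0 0] x by (simp add: True santalo_region_def)
next
  case False
  let ?v = "(unit_ball_volume TYPE('a))\<^sup>2" and ?c = "measure lebesgue K"
  let ?r = "?c * measure lebesgue (polar K x) / ?v"
  have K: "bounded K" "closed K" "convex K" and int0: "0 \<in> interior K"
    using body san compact_imp_closed compact_imp_bounded by (auto simp: convex_body_def is_santalo_point_def)
  have xK: "x \<in> K" and fin: "emeasure lebesgue (polar K x) < \<infinity>" and le: "?r \<le> t"
    using x by (auto simp: mem_santalo_region_iff[OF body])
  have c: "0 < ?c" using convex_body_measure[OF body] by simp
  \<comment> \<open>Passes from transforms to volume ratios; it is applied three times, with different factors.\<close>
  have scale: "a * santalo_ratio K \<le> b * ?r" if "a * laplace K 0 \<le> b * laplace K x" for a b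
  proof -
    have "a * measure lebesgue (polar K 0) \<le> b * measure lebesgue (polar K x)"
      using that laplace_eq_polar[OF K(1) xK fin]
        laplace_eq_polar[OF K(1) subsetD[OF interior_subset int0] polar_finite[OF int0]]
      by (simp add: mult.left_commute[of _ "fact _"])
    then have "(?c / ?v) * (a * measure lebesgue (polar K 0)) \<le> (?c / ?v) * (b * measure lebesgue (polar K x))"
      using c by (intro mult_left_mono) auto
    then show ?thesis by (simp add: santalo_ratio_def mult_ac)
  qed
  obtain d u where d: "0 < d" "d *\<^sub>R x \<in> K" and u: "u \<bullet> (d *\<^sub>R x) = 1" "supp_fun K u \<le> 1"
    using boundary_point_with_normal[OF K int0 False] by blast
  define \<rho> z where "\<rho> = 1 / d" and "z = d *\<^sub>R x"
  have z: "z \<in> K" "\<rho> *\<^sub>R z = x" "u \<bullet> z = 1" and \<rho>0: "0 \<le> \<rho>" using d u by (auto simp: \<rho>_def z_def)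
  have "u \<bullet> x \<le> 1" using inner_le_supp_fun[OF K(1) xK, of u] u(2) by linarith
  moreover have "u \<bullet> x = \<rho>" using z(2,3) by (metis inner_scaleR_right mult.right_neutral)
  ultimately have \<rho>1: "\<rho> \<le> 1" by simp
  have fin': "\<rho> *\<^sub>R z \<in> K" "emeasure lebesgue (polar K (\<rho> *\<^sub>R z)) < \<infinity>" using xK fin z by auto
  have lb: "exp (- \<rho>) * laplace K 0 \<le> (1 - \<rho>) * laplace K x"
    using laplace_lower_bound[OF body san z(3) u(2) \<rho>0 fin'] z by simp
  have "0 < laplace K 0"
    using laplace_eq_polar[OF K(1) subsetD[OF interior_subset int0] polar_finite[OF int0]]
      polar_zero_pos[OF K(1) int0] by simp
  then have "0 < exp (- \<rho>) * laplace K 0" by simp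
  then have "\<rho> \<noteq> 1" using lb by auto
  then have \<rho>: "\<rho> < 1" using \<rho>1 by simp
  have "z - (1 - \<rho>) *\<^sub>R (z - 0) \<in> interior K"
    using mem_interior_convex_shrink[OF K(3) int0 z(1), of "1 - \<rho>"] \<rho> \<rho>0 by simp
  then have "x \<in> interior K" using z(2) by (simp add: algebra_simps)
  then have "1 * laplace K 0 \<le> 1 * laplace K x" using laplace_zero_le[OF body san] by simp
  then have r1: "santalo_ratio K \<le> t" using scale[of 1 1] le by simp
  have "(1 - \<rho>) * ?r \<le> (1 - \<rho>) * t" using le \<rho> by (intro mult_left_mono) auto
  then have r2: "exp (- \<rho>) * santalo_ratio K \<le> (1 - \<rho>) * t" using scale[OF lb] by linarith
  have r3: "santalo_ratio K \<le> (1 - \<rho>\<^sup>2) * t" if sym: "K = uminus ` K"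
  proof -
    have "1 * laplace K 0 \<le> (1 - \<rho>\<^sup>2) * laplace K x"
      using laplace_lower_bound_symmetric[OF K(1) int0 sym z(3) u(2) \<rho>0 \<rho>1 fin'] z by simp
    then have "1 * santalo_ratio K \<le> (1 - \<rho>\<^sup>2) * ?r" by (rule scale)
    also have "\<dots> \<le> (1 - \<rho>\<^sup>2) * t"
      using le power_le_one[OF \<rho>0 \<rho>1, of 2] by (intro mult_left_mono) auto
    finally show ?thesis by simp
  qed
  show ?thesis using that[OF z(1) z(2)[symmetric] \<rho>0 \<rho> r1 r2 r3] .
qed

lemma dilate_mono:
  assumes "convex K" "0 \<in> K" "z \<in> K" "0 \<le> \<rho>" "\<rho> \<le> c"
  shows "\<rho> *\<^sub>R z \<in> (\<lambda>x. c *\<^sub>R x) ` K"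
proof (cases "c = 0")
  case False
  then have "(\<rho> / c) *\<^sub>R z + (1 - \<rho> / c) *\<^sub>R 0 \<in> K"
    using assms by (intro convexD) auto
  then show ?thesis using False by (intro image_eqI[of _ _ "(\<rho> / c) *\<^sub>R z"]) auto
qed (use assms in \<open>auto intro!: image_eqI[of _ _ 0]\<close>)

text \<open>
  If \<open>h y - (1 - \<rho>) (y \<bullet> w) \<le> 1\<close>, then \<open>y \<bullet> w \<le> h y\<close> gives \<open>\<rho> h y \<le> 1\<close>.
\<close>
lemma polar_shrink_subset:
  assumes K: "bounded K" and w: "w \<in> K" and \<rho>: "0 < \<rho>" "\<rho> \<le> 1"
  shows "polar K ((1 - \<rho>) *\<^sub>R w) \<subseteq> (\<lambda>y. (1 / \<rho>) *\<^sub>R y) ` polar K 0"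
proof
  fix y assume y: "y \<in> polar K ((1 - \<rho>) *\<^sub>R w)"
  have ne: "K \<noteq> {}" using w by auto
  have "supp_fun K y \<le> 1 + (1 - \<rho>) * (y \<bullet> w)"
    using y unfolding supp_fun_le_iff[OF K ne] polar_def by (auto simp: inner_diff_right diff_le_eq)
  also have "\<dots> \<le> 1 + (1 - \<rho>) * supp_fun K y"
    using inner_le_supp_fun[OF K w] \<rho> by (intro add_left_mono mult_left_mono) auto
  finally have "supp_fun K (\<rho> *\<^sub>R y) \<le> 1"
    using \<rho> supp_fun_scaleR[OF K ne \<rho>(1), of y] by (simp add: algebra_simps)
  then have "\<rho> *\<^sub>R y \<in> polar K 0" unfolding supp_fun_le_iff[OF K ne] by (simp add: polar_def)
  then show "y \<in> (\<lambda>y. (1 / \<rho>) *\<^sub>R y) ` polar K 0"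
    using \<rho> by (intro image_eqI[of _ _ "\<rho> *\<^sub>R y"]) auto
qed

text \<open>
  The root is the \<open>\<rho>\<close> for which the bound \<open>1 / \<rho>\<^sup>n\<close> on the growth of the polar volume takes the
  ratio from its value at the origin exactly to \<open>t\<close>.
\<close>
lemma santalo_region_superset:
  fixes K :: "'a::euclidean_space set"
  assumes body: "convex_body K" and int0: "0 \<in> interior K" and t: "santalo_ratio K \<le> t"
    and n: "n = DIM('a)"
  shows "(\<lambda>x. (1 - root n (santalo_ratio K / t)) *\<^sub>R x) ` K \<subseteq> santalo_region K t"
proof (rule image_subsetI)
  fix w assume w: "w \<in> K"
  let ?v = "(unit_ball_volume TYPE('a))\<^sup>2" and ?c = "measure lebesgue K"
  define \<rho> where "\<rho> = root n (santalo_ratio K / t)"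
  have K: "bounded K" "convex K"
    using body compact_imp_bounded by (auto simp: convex_body_def)
  have c: "0 < ?c" using convex_body_measure[OF body] by simp
  have "0 < measure lborel (cball (0::'a) 1)" by (rule content_cball_pos) simp
  then have v: "0 < ?v" by (simp add: unit_ball_volume_def)
  have rpos: "0 < santalo_ratio K"
    using c v polar_zero_pos[OF K(1) int0] by (simp add: santalo_ratio_def)
  have n0: "0 < n" by (simp add: n)
  have \<rho>: "0 < \<rho>" "\<rho> \<le> 1" "\<rho> ^ n = santalo_ratio K / t"
    using n0 rpos t by (auto simp: \<rho>_def real_root_gt_zero)
  let ?x = "(1 - \<rho>) *\<^sub>R w"
  have sub: "polar K ?x \<subseteq> (\<lambda>y. (1 / \<rho>) *\<^sub>R y + 0) ` polar K 0"
    using polar_shrink_subset[OF K(1) w \<rho>(1,2)] by simp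
  have fin0: "emeasure lebesgue (polar K 0) = ennreal (measure lebesgue (polar K 0))"
    using polar_finite[OF int0] by (intro emeasure_eq_ennreal_measure) auto
  have "closed ((\<lambda>y. (1 / \<rho>) *\<^sub>R y) ` polar K 0)"
    by (rule closed_scaling[OF closed_polar])
  then have "emeasure lebesgue (polar K ?x) \<le> emeasure lebesgue ((\<lambda>y. (1 / \<rho>) *\<^sub>R y + 0) ` polar K 0)"
    using sub by (intro emeasure_mono) auto
  also have "\<dots> = ennreal ((1 / \<rho>) ^ n * measure lebesgue (polar K 0))"
    using emeasure_lebesgue_affine[of "1 / \<rho>" 0 "polar K 0"] \<rho>(1)
    by (simp add: n fin0 ennreal_mult ennreal_power del: power_divide)
  finally have e: "emeasure lebesgue (polar K ?x) \<le> ennreal ((1 / \<rho>) ^ n * measure lebesgue (polar K 0))" .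
  then have fin: "emeasure lebesgue (polar K ?x) < \<infinity>" by (auto intro: le_less_trans)
  have "measure lebesgue (polar K ?x) \<le> (1 / \<rho>) ^ n * measure lebesgue (polar K 0)"
    unfolding measure_def[of lebesgue "polar K ?x"] using e \<rho>(1) by (intro enn2real_leI) auto
  then have "(?c / ?v) * measure lebesgue (polar K ?x) \<le> (?c / ?v) * ((1 / \<rho>) ^ n * measure lebesgue (polar K 0))"
    using c by (intro mult_left_mono) auto
  also have "\<dots> = santalo_ratio K / \<rho> ^ n" by (simp add: santalo_ratio_def power_divide mult_ac)
  also have "\<dots> = t" using \<rho>(3) rpos by simp
  finally have "?c * measure lebesgue (polar K ?x) / ?v \<le> t" by simp
  moreover have "?x \<in> K"
    using convexD[OF K(2) w subsetD[OF interior_subset int0], of "1 - \<rho>" \<rho>] \<rho> by simp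
  ultimately show "(1 - root n (santalo_ratio K / t)) *\<^sub>R w \<in> santalo_region K t"
    using fin unfolding \<rho>_def[symmetric] by (simp add: mem_santalo_region_iff[OF body])
qed

theorem theorem9:
  fixes K :: "(real ^ 'n) set" and t :: real
  assumes "convex_body K" and "is_santalo_point K 0"
  shows "(santalo_region K t \<noteq> {} \<longleftrightarrow> t \<ge> santalo_ratio K) \<and>
    (santalo_region K t \<noteq> {} \<longrightarrow>
      ((\<lambda>x. (1 - root CARD('n) (santalo_ratio K / t)) *\<^sub>R x) ` K \<subseteq> santalo_region K t \<and>
       santalo_region K t \<subseteq> (\<lambda>x. (1 - santalo_ratio K / (exp 1 * t)) *\<^sub>R x) ` K) \<and>
      (K = uminus ` K \<longrightarrow>
       (\<lambda>x. (1 - root CARD('n) (santalo_ratio K / t)) *\<^sub>R x) ` K \<subseteq> santalo_region K t \<and>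
       santalo_region K t \<subseteq> (\<lambda>x. sqrt (1 - santalo_ratio K / t) *\<^sub>R x) ` K))"
proof -
  have int0: "0 \<in> interior K" and K: "bounded K" "convex K"
    using assms compact_imp_bounded by (auto simp: is_santalo_point_def convex_body_def)
  have zero: "0 \<in> K" using int0 interior_subset by blast
  have "0 < measure lborel (cball (0::real^'n) 1)" by (rule content_cball_pos) simp
  then have pos: "0 < santalo_ratio K"
    using polar_zero_pos[OF K(1) int0] convex_body_measure(1)[OF assms(1)]
    by (simp add: santalo_ratio_def unit_ball_volume_def)
  have ne_iff: "santalo_region K t \<noteq> {} \<longleftrightarrow> t \<ge> santalo_ratio K"
  proof
    assume "santalo_region K t \<noteq> {}"
    then obtain x where "x \<in> santalo_region K t" by blast
    then show "t \<ge> santalo_ratio K" by (rule santalo_region_radial_bound[OF assms])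
  next
    assume "t \<ge> santalo_ratio K"
    then have "0 \<in> santalo_region K t"
      unfolding mem_santalo_region_iff[OF assms(1)] using zero polar_finite[OF int0]
      by (simp add: santalo_ratio_def)
    then show "santalo_region K t \<noteq> {}" by blast
  qed
  have lower: "(\<lambda>x. (1 - root CARD('n) (santalo_ratio K / t)) *\<^sub>R x) ` K \<subseteq> santalo_region K t"
    if "santalo_ratio K \<le> t"
    by (rule santalo_region_superset[OF assms(1) int0 that]) simp
  have upper: "santalo_region K t \<subseteq> (\<lambda>x. (1 - santalo_ratio K / (exp 1 * t)) *\<^sub>R x) ` K"
  proof
    fix x assume "x \<in> santalo_region K t"
    then obtain \<rho> z where z: "z \<in> K" "x = \<rho> *\<^sub>R z" "0 \<le> \<rho>" "\<rho> < 1" "santalo_ratio K \<le> t"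
      and le: "exp (- \<rho>) * santalo_ratio K \<le> (1 - \<rho>) * t"
      by (rule santalo_region_radial_bound[OF assms])
    \<comment> \<open>The constant \<open>e\<close> arises from replacing \<open>exp (- \<rho>)\<close> by its smallest value on \<open>[0, 1]\<close>.\<close>
    have "exp (- 1) * santalo_ratio K \<le> exp (- \<rho>) * santalo_ratio K"
      using z pos by (intro mult_right_mono) auto
    then have "santalo_ratio K \<le> exp 1 * ((1 - \<rho>) * t)"
      using le mult_left_mono[of "exp (- 1) * santalo_ratio K" "(1 - \<rho>) * t" "exp 1"]
      by (simp add: mult.assoc[symmetric] mult_exp_exp)
    then have "santalo_ratio K / (exp 1 * t) \<le> 1 - \<rho>"
      using pos z(5) by (simp add: pos_divide_le_eq mult_ac)
    then show "x \<in> (\<lambda>x. (1 - santalo_ratio K / (exp 1 * t)) *\<^sub>R x) ` K"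
      using dilate_mono[OF K(2) zero z(1,3)] z(2) by simp
  qed
  have upper_sym: "santalo_region K t \<subseteq> (\<lambda>x. sqrt (1 - santalo_ratio K / t) *\<^sub>R x) ` K"
    if sym: "K = uminus ` K"
  proof
    fix x assume "x \<in> santalo_region K t"
    then obtain \<rho> z where z: "z \<in> K" "x = \<rho> *\<^sub>R z" "0 \<le> \<rho>" "\<rho> < 1" "santalo_ratio K \<le> t"
      and le: "santalo_ratio K \<le> (1 - \<rho>\<^sup>2) * t"
      using santalo_region_radial_bound[OF assms] sym by metis
    have "santalo_ratio K / t \<le> 1 - \<rho>\<^sup>2" using pos z(5) le by (simp add: pos_divide_le_eq)
    then have "\<rho> \<le> sqrt (1 - santalo_ratio K / t)" by (intro real_le_rsqrt) simp
    then show "x \<in> (\<lambda>x. sqrt (1 - santalo_ratio K / t) *\<^sub>R x) ` K"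
      using dilate_mono[OF K(2) zero z(1,3)] z(2) by simp
  qed
  show ?thesis using ne_iff lower upper upper_sym by blast
qed

end
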